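(* Let $p(t)$ be an interior trajectory of the residual flow on the simplex, and put $W(t)=\int_0^t z(s)\,ds$, where $z(s)=z(p(s))$. Then \[ p_i(t)=\frac{p_i(0)\exp\left(-4t|\lambda_i|^2+8\operatorname{Re}(\overline{\lambda_i}W(t))\right)}{\sum_j p_j(0)\exp\left(-4t|\lambda_j|^2+8\operatorname{Re}(\overline{\lambda_j}W(t))\right)}. \] Equivalently, $W$ is the solution of the single complex nonautonomous equation \[ \dot W=\frac{\sum_i\lambda_i p_i(0)\exp\left(-4t|\lambda_i|^2+8\operatorname{Re}(\overline{\lambda_i}W)\right)}{\sum_i p_i(0)\exp\left(-4t|\lambda_i|^2+8\operatorname{Re}(\overline{\lambda_i}W)\right)},\qquad W(0)=0. \] Thus a generic trajectory in the $(n-1)$-dimensional simplex is contained in a three-real-dimensional exponential family parametrized by $t$, $\operatorname{Re}W$, and $\operatorname{Im}W$.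
   Context: Let $A\in M_n(\mathbb C)$ be normal, written in an orthonormal eigenbasis as $A=\operatorname{diag}(\lambda_1,\dots,\lambda_n)$ with $\lambda_i\in\mathbb C$. For a unit vector $u\in\mathbb C^n$ put $p_i=|u_i|^2$. The negative gradient flow of the squared Rayleigh residual $\|Au-(u^*Au)u\|^2$ induces on the simplex $\Delta^{n-1}=\{p\in\mathbb R^n:p_i\ge0,\ \sum_i p_i=1\}$ the residual flow \[ \dot p_i=4p_i\left(\rho(p)-|\lambda_i-z(p)|^2\right),\qquad z(p)=\sum_j p_j\lambda_j,\quad \rho(p)=\sum_j p_j|\lambda_j-z(p)|^2 . \] An interior trajectory is one lying in the interior of the simplex, i.e. with all $p_i(t)>0$. The exponential family in the last sentence is the one given by the first displayed formula, with $p(0)$ fixed and with $t$, $\operatorname{Re}W$, $\operatorname{Im}W$ regarded as real parameters; the word "generic" there is used without further specification. *)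

theory Defs
  imports "HOL-Analysis.Analysis"
begin

text \<open>The vector \<open>lam\<close> lists the eigenvalues of the normal matrix \<open>A = diag(lam)\<close>,
  with multiplicity, in an orthonormal eigenbasis.\<close>

definition prob_simplex :: "(real ^ 'n) set" where
  "prob_simplex = {p. (\<forall>i. 0 \<le> p $ i) \<and> (\<Sum>i\<in>UNIV. p $ i) = 1}"

text \<open>The relative interior of the simplex (its topological interior in \<open>\<real>\<^sup>n\<close> is empty).\<close>

definition open_simplex :: "(real ^ 'n) set" where
  "open_simplex = {p. (\<forall>i. 0 < p $ i) \<and> (\<Sum>i\<in>UNIV. p $ i) = 1}"

definition zmean :: "complex ^ 'n \<Rightarrow> real ^ 'n \<Rightarrow> complex" where
  "zmean lam p = (\<Sum>j\<in>UNIV. of_real (p $ j) * lam $ j)"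

definition rho :: "complex ^ 'n \<Rightarrow> real ^ 'n \<Rightarrow> real" where
  "rho lam p = (\<Sum>j\<in>UNIV. p $ j * (cmod (lam $ j - zmean lam p))\<^sup>2)"

definition residual_field :: "complex ^ 'n \<Rightarrow> real ^ 'n \<Rightarrow> real ^ 'n" where
  "residual_field lam p =
     (\<chi> i. 4 * p $ i * (rho lam p - (cmod (lam $ i - zmean lam p))\<^sup>2))"

text \<open>Trajectories on a time interval \<open>T\<close>; derivatives at end points belonging to \<open>T\<close> are
  one-sided.\<close>

definition residual_trajectory :: "complex ^ 'n \<Rightarrow> real set \<Rightarrow> (real \<Rightarrow> real ^ 'n) \<Rightarrow> bool" where
  "residual_trajectory lam T p \<longleftrightarrow>
     (\<forall>t\<in>T. p t \<in> prob_simplex) \<and>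
     (\<forall>t\<in>T. (p has_vector_derivative residual_field lam (p t)) (at t within T))"

definition interior_trajectory :: "complex ^ 'n \<Rightarrow> real set \<Rightarrow> (real \<Rightarrow> real ^ 'n) \<Rightarrow> bool" where
  "interior_trajectory lam T p \<longleftrightarrow>
     residual_trajectory lam T p \<and> (\<forall>t\<in>T. p t \<in> open_simplex)"

text \<open>The integral is oriented: for \<open>t < 0\<close> it is minus the integral over \<open>[t, 0]\<close>.\<close>

definition Wint :: "complex ^ 'n \<Rightarrow> (real \<Rightarrow> real ^ 'n) \<Rightarrow> real \<Rightarrow> complex" where
  "Wint lam p t = (LBINT s=0..t. zmean lam (p s))"

definition expweight :: "complex ^ 'n \<Rightarrow> real \<Rightarrow> complex \<Rightarrow> 'n \<Rightarrow> real" where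
  "expweight lam t w i = exp (- 4 * t * (cmod (lam $ i))\<^sup>2 + 8 * Re (cnj (lam $ i) * w))"

definition W_field :: "complex ^ 'n \<Rightarrow> real ^ 'n \<Rightarrow> real \<Rightarrow> complex \<Rightarrow> complex" where
  "W_field lam p0 t w =
     (\<Sum>i\<in>UNIV. lam $ i * of_real (p0 $ i * expweight lam t w i)) /
     of_real (\<Sum>i\<in>UNIV. p0 $ i * expweight lam t w i)"

definition W_solution ::
    "complex ^ 'n \<Rightarrow> real ^ 'n \<Rightarrow> real set \<Rightarrow> (real \<Rightarrow> complex) \<Rightarrow> bool" where
  "W_solution lam p0 T W \<longleftrightarrow>
     W 0 = 0 \<and> (\<forall>t\<in>T. (W has_vector_derivative W_field lam p0 t (W t)) (at t within T))"

text \<open>The parameters \<open>(t, a, b)\<close> stand for \<open>t\<close>, \<open>Re W\<close>, \<open>Im W\<close>.\<close>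

definition expfam :: "complex ^ 'n \<Rightarrow> real ^ 'n \<Rightarrow> real \<times> real \<times> real \<Rightarrow> real ^ 'n" where
  "expfam lam p0 = (\<lambda>(t, a, b). \<chi> i.
     p0 $ i * expweight lam t (Complex a b) i /
     (\<Sum>j\<in>UNIV. p0 $ j * expweight lam t (Complex a b) j))"

text \<open>A \<open>C\<^sup>1\<close> immersion that is a homeomorphism onto its image, so that the image is an embedded
  submanifold of dimension \<open>DIM('a)\<close>.\<close>

definition regular_embedding :: "('a::euclidean_space \<Rightarrow> 'b::euclidean_space) \<Rightarrow> bool" where
  "regular_embedding f \<longleftrightarrow>
     (\<exists>D. (\<forall>x. (f has_derivative blinfun_apply (D x)) (at x)) \<and>
          continuous_on UNIV D \<and> (\<forall>x. inj (blinfun_apply (D x)))) \<and>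
     (\<exists>g. homeomorphism UNIV (range f) f g)"

text \<open>The eigenvalues lie neither on a common real line nor on a common circle, i.e. the functions
  \<open>1\<close>, \<open>|z|\<^sup>2\<close>, \<open>Re z\<close>, \<open>Im z\<close> are linearly independent on the spectrum. On a common line or
  circle (in particular if \<open>n < 4\<close>) the family has dimension less than three.\<close>

definition generic_spectrum :: "complex ^ 'n \<Rightarrow> bool" where
  "generic_spectrum lam \<longleftrightarrow>
     \<not> collinear (range (\<lambda>i. lam $ i)) \<and>
     \<not> (\<exists>c r. range (\<lambda>i. lam $ i) \<subseteq> sphere c r)"

end

theory Submission
  imports Defs
begin

text \<open>The substance is that the residual flow is a replicator equation whose fitness is affine in the
  single complex number \<open>z\<close>. Expanding the squares and using \<open>\<Sum>i. p\<^sub>i = 1\<close>, the field becomes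
  \<open>p\<^sub>i (L\<^sub>i(1, Re z, Im z) - \<Sum>j. p\<^sub>j L\<^sub>j(1, Re z, Im z))\<close>, where
  \<open>L\<^sub>i(t, a, b) = - 4 t |\<lambda>\<^sub>i|\<^sup>2 + 8 Re (cnj \<lambda>\<^sub>i (a + b \<i>))\<close> is linear on \<open>\<real>\<^sup>3\<close>
  (\<open>residual_field_eq_replicator\<close>). The subtracted mean does not depend on \<open>i\<close>, so it
  only rescales all weights by one common factor \<open>exp (- \<Phi> t)\<close>, while the remaining terms integrate
  to \<open>L\<^sub>i(t, Re W, Im W)\<close> because \<open>W' = z\<close>. Hence \<open>p\<^sub>i(t) exp (\<Phi> t - L\<^sub>i(t, Re W, Im W))\<close> is
  constant, and the normalisation \<open>\<Sum>i. p\<^sub>i = 1\<close> eliminates \<open>\<Phi>\<close> (\<open>residual_trajectory_eq_expfam\<close>).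
  The argument divides by no \<open>p\<^sub>i\<close>, so it covers every trajectory in the closed simplex that starts
  in the interior, and the resulting formula shows that such a trajectory stays there.

  In the other direction, the derivative of the exponential family is the same replicator
  expression (\<open>has_derivative_expfam\<close>), so the chain rule turns each solution of the equation for \<open>W\<close>
  into a trajectory. That solution is unique because the right-hand side is a mean of the eigenvalues
  under Gibbs weights: its derivative in \<open>W\<close> is a covariance of the eigenvalues,
  bounded uniformly in \<open>t\<close> and \<open>W\<close>, so it is globally Lipschitz (\<open>W_field_lipschitz\<close>) and a Gronwall
  estimate applies in both time directions (\<open>zero_if_linear_growth\<close>).

  The exponential family is softmax after the linear map \<open>x \<mapsto> (L\<^sub>i x)\<^sub>i\<close>. Logarithms of quotients
  undo softmax up to an additive constant, so the family is an embedding as soon as no nonzero \<open>x\<close> makes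
  all \<open>L\<^sub>i x\<close> equal (\<open>regular_embedding_expfam\<close>). Such an \<open>x\<close> holds the coefficients of a circle
  (\<open>t \<noteq> 0\<close>) or of a line (\<open>t = 0\<close>) through all eigenvalues (\<open>generic_spectrum_iff\<close>).
  Spectra admitting such an equation form a closed set, since the coefficients may be
  normalised to the compact unit sphere; and they are nowhere dense once there are four eigenvalues, because
  on a segment towards a generic spectrum the determinant that detects genericity is a nonzero
  polynomial, which has finitely many roots.\<close>

section \<open>Gibbs weights and their derivative\<close>

lemma has_derivative_vecI:
  fixes f :: "'a::real_normed_vector \<Rightarrow> real ^ 'n"
  assumes "\<And>i. ((\<lambda>x. f x $ i) has_derivative (\<lambda>h. f' h $ i)) F"
    and F: "F = at x within S"
  shows "(f has_derivative f') F"
  using assms(1) unfolding F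
  by (subst has_derivative_componentwise_within) (auto simp: Basis_vec_def inner_axis)

lemma has_vector_derivative_vec_nth:
  fixes f :: "real \<Rightarrow> real ^ 'n"
  assumes "(f has_vector_derivative D) F"
  shows "((\<lambda>x. f x $ i) has_vector_derivative D $ i) F"
  using bounded_linear.has_vector_derivative[OF bounded_linear_vec_nth assms] .

lemma open_simplexD:
  assumes "p \<in> open_simplex"
  shows "0 < p $ i" "(\<Sum>j\<in>UNIV. p $ j) = 1"
  using assms by (auto simp: open_simplex_def)

text \<open>The exponent of the \<open>i\<close>-th weight, with \<open>t\<close>, \<open>Re W\<close> and \<open>Im W\<close> bundled into one
  vector: linearity in this vector is what makes \<open>expfam\<close> an exponential family.\<close>

definition log_weight :: "complex ^ 'n \<Rightarrow> 'n \<Rightarrow> real \<times> real \<times> real \<Rightarrow> real" where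
  "log_weight lam i = (\<lambda>(t, a, b).
     8 * (a * Re (lam $ i) + b * Im (lam $ i)) - 4 * t * (cmod (lam $ i))\<^sup>2)"

lemma bounded_linear_log_weight: "bounded_linear (log_weight lam i)"
proof -
  have "log_weight lam i = (\<lambda>x. 8 * (fst (snd x) * Re (lam $ i) + snd (snd x) * Im (lam $ i))
          - 4 * fst x * (cmod (lam $ i))\<^sup>2)"
    by (auto simp: log_weight_def)
  then have "linear (log_weight lam i)"
    by (auto intro!: linearI simp: algebra_simps)
  then show ?thesis
    by (simp add: linear_conv_bounded_linear)
qed

lemmas log_weight_add = linear_add[OF bounded_linear.linear[OF bounded_linear_log_weight]]
lemmas log_weight_scale = linear_scale[OF bounded_linear.linear[OF bounded_linear_log_weight]]
lemmas log_weight_zero [simp] = linear_0[OF bounded_linear.linear[OF bounded_linear_log_weight]]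
lemmas has_derivative_log_weight [derivative_intros] =
  bounded_linear.has_derivative[OF bounded_linear_log_weight]
lemmas continuous_on_log_weight [continuous_intros] =
  bounded_linear.continuous_on[OF bounded_linear_log_weight]

lemma expweight_eq: "expweight lam t w i = exp (log_weight lam i (t, Re w, Im w))"
  by (simp add: expweight_def log_weight_def algebra_simps)

lemma expfam_nth:
  "expfam lam p0 x $ i =
     p0 $ i * exp (log_weight lam i x) / (\<Sum>j\<in>UNIV. p0 $ j * exp (log_weight lam j x))"
  by (cases x) (simp add: expfam_def expweight_eq)

lemma partition_sum_pos:
  assumes "p0 \<in> open_simplex"
  shows "0 < (\<Sum>j\<in>UNIV. p0 $ j * exp (log_weight lam j x))"
  using open_simplexD(1)[OF assms] by (auto intro!: sum_pos)

lemma expfam_in_open_simplex: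
  assumes "p0 \<in> open_simplex"
  shows "expfam lam p0 x \<in> open_simplex"
  using open_simplexD(1)[OF assms] partition_sum_pos[OF assms, of lam x]
  by (auto simp: open_simplex_def expfam_nth simp flip: sum_divide_distrib)

lemma expfam_zero:
  assumes "p0 \<in> open_simplex"
  shows "expfam lam p0 0 = p0"
  using open_simplexD(2)[OF assms] by (simp add: vec_eq_iff expfam_nth)

lemma W_field_eq_zmean: "W_field lam p0 t w = zmean lam (expfam lam p0 (t, Re w, Im w))"
  by (simp add: W_field_def zmean_def expfam_nth expweight_eq sum_divide_distrib mult_ac)

text \<open>The replicator field with fitness \<open>L\<^sub>i(h)\<close>. It serves both as the differential of \<open>expfam\<close>
  applied to \<open>h\<close> and, with \<open>h = (1, Re z, Im z)\<close>, as the residual field.\<close>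

definition replicator :: "complex ^ 'n \<Rightarrow> real ^ 'n \<Rightarrow> real \<times> real \<times> real \<Rightarrow> real ^ 'n" where
  "replicator lam p h =
     (\<chi> i. p $ i * (log_weight lam i h - (\<Sum>j\<in>UNIV. p $ j * log_weight lam j h)))"

lemma has_derivative_expfam:
  assumes "p0 \<in> open_simplex"
  shows "(expfam lam p0 has_derivative replicator lam (expfam lam p0 x)) (at x within S)"
proof (rule has_derivative_vecI[OF _ refl])
  fix i
  let ?S = "\<lambda>x. \<Sum>j\<in>UNIV. p0 $ j * exp (log_weight lam j x)"
  have S: "?S x \<noteq> 0"
    using partition_sum_pos[OF assms, of lam x] by simp
  have avg: "(\<Sum>j\<in>UNIV. expfam lam p0 x $ j * log_weight lam j h) =
      (\<Sum>j\<in>UNIV. p0 $ j * (log_weight lam j h * exp (log_weight lam j x))) / ?S x" for h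
    by (simp add: expfam_nth sum_divide_distrib mult_ac)
  have "((\<lambda>x. p0 $ i * exp (log_weight lam i x) / ?S x) has_derivative
      (\<lambda>h. replicator lam (expfam lam p0 x) h $ i)) (at x within S)"
    by (rule has_derivative_eq_rhs, (rule derivative_intros S)+, rule ext)
      (use S in \<open>simp add: replicator_def avg expfam_nth field_simps power2_eq_square
        flip: sum_divide_distrib\<close>)
  then show "((\<lambda>x. expfam lam p0 x $ i) has_derivative
      (\<lambda>h. replicator lam (expfam lam p0 x) h $ i)) (at x within S)"
    by (simp add: expfam_nth)
qed

text \<open>Write \<open>M = \<Sum>j. p\<^sub>j |\<lambda>\<^sub>j|\<^sup>2\<close>. Then \<open>\<rho> = M - |z|\<^sup>2\<close> and the mean of \<open>L\<^sub>j(1, Re z, Im z)\<close> is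
  \<open>8 |z|\<^sup>2 - 4 M\<close>, so both sides equal
  \<open>4 p\<^sub>i (M - 2 |z|\<^sup>2 - |\<lambda>\<^sub>i|\<^sup>2 + 2 Re (cnj \<lambda>\<^sub>i z))\<close>.\<close>

lemma residual_field_eq_replicator:
  assumes "(\<Sum>j\<in>UNIV. p $ j) = 1"
  shows "residual_field lam p = replicator lam p (1, Re (zmean lam p), Im (zmean lam p))"
proof -
  define z where "z = zmean lam p"
  define M where "M = (\<Sum>j\<in>UNIV. p $ j * (cmod (lam $ j))\<^sup>2)"
  have sq: "(cmod (w - z))\<^sup>2 = (cmod w)\<^sup>2 - 2 * (Re z * Re w + Im z * Im w) + (cmod z)\<^sup>2" for w
    unfolding cmod_power2 by (simp add: power2_eq_square algebra_simps)
  have Re_z: "(\<Sum>j\<in>UNIV. p $ j * Re (lam $ j)) = Re z"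
    and Im_z: "(\<Sum>j\<in>UNIV. p $ j * Im (lam $ j)) = Im z"
    by (simp_all add: z_def zmean_def)
  have mean: "(\<Sum>j\<in>UNIV. p $ j * (Re z * Re (lam $ j) + Im z * Im (lam $ j))) = (cmod z)\<^sup>2"
  proof -
    have "(\<Sum>j\<in>UNIV. p $ j * (Re z * Re (lam $ j) + Im z * Im (lam $ j))) =
        Re z * (\<Sum>j\<in>UNIV. p $ j * Re (lam $ j)) + Im z * (\<Sum>j\<in>UNIV. p $ j * Im (lam $ j))"
      by (simp add: sum_distrib_left algebra_simps sum.distrib)
    then show ?thesis
      unfolding Re_z Im_z cmod_power2 by (simp add: power2_eq_square)
  qed
  have rho: "rho lam p = M - (cmod z)\<^sup>2"
  proof -
    have "rho lam p = (\<Sum>j\<in>UNIV. p $ j * (cmod (lam $ j))\<^sup>2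
        - 2 * (p $ j * (Re z * Re (lam $ j) + Im z * Im (lam $ j))) + p $ j * (cmod z)\<^sup>2)"
      unfolding rho_def z_def[symmetric] sq by (intro sum.cong refl) (simp only: algebra_simps)
    also have "\<dots> = M - 2 * (cmod z)\<^sup>2 + (cmod z)\<^sup>2"
      by (simp add: sum.distrib sum_subtractf M_def mean assms
          flip: sum_distrib_left sum_distrib_right)
    finally show ?thesis by simp
  qed
  have "(\<Sum>j\<in>UNIV. p $ j * log_weight lam j (1, Re z, Im z)) =
      (\<Sum>j\<in>UNIV. 8 * (p $ j * (Re z * Re (lam $ j) + Im z * Im (lam $ j)))
        - 4 * (p $ j * (cmod (lam $ j))\<^sup>2))"
    by (intro sum.cong refl) (simp only: log_weight_def prod.case, algebra)
  also have "\<dots> = 8 * (cmod z)\<^sup>2 - 4 * M"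
    by (simp add: sum_subtractf M_def mean flip: sum_distrib_left)
  finally have avg: "(\<Sum>j\<in>UNIV. p $ j * log_weight lam j (1, Re z, Im z)) = 8 * (cmod z)\<^sup>2 - 4 * M" .
  show ?thesis
    unfolding replicator_def residual_field_def z_def[symmetric] avg rho sq
    by (simp add: vec_eq_iff log_weight_def algebra_simps)
qed

section \<open>Calculus on an arbitrary interval of time\<close>

text \<open>Near \<open>t\<close>, an interval of any kind agrees with a compact one that contains \<open>0\<close> and \<open>t\<close>. This carries
  the fundamental theorem of calculus from compact segments over to open, half-open
  and unbounded intervals with one-sided derivatives at the end points.\<close>

lemma interval_segment_nhd:
  fixes T :: "real set"
  assumes T: "is_interval T" "0 \<in> T" "t \<in> T"
  obtains a b where "a \<le> 0" "0 \<le> b" "a \<le> t" "t \<le> b" "{a..b} \<subseteq> T"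
    "at t within T = at t within {a..b}"
proof -
  have "\<exists>a\<in>T. a \<le> min 0 t \<and> (a < t \<or> (\<forall>y\<in>T. t \<le> y))"
  proof (cases "\<exists>y\<in>T. y < min 0 t")
    case True
    then show ?thesis by (auto intro: less_imp_le)
  next
    case False
    have "min 0 t \<in> T" using T by (simp add: min_def)
    moreover have "min 0 t < t \<or> (\<forall>y\<in>T. t \<le> y)"
      using False by (cases "0 < t") (auto simp: not_less min_def)
    ultimately show ?thesis by blast
  qed
  then obtain a where a: "a \<in> T" "a \<le> 0" "a \<le> t" "a < t \<or> (\<forall>y\<in>T. t \<le> y)"
    unfolding min.bounded_iff by blast
  have "\<exists>b\<in>T. max 0 t \<le> b \<and> (t < b \<or> (\<forall>y\<in>T. y \<le> t))"
  proof (cases "\<exists>y\<in>T. max 0 t < y")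
    case True
    then show ?thesis by (auto intro: less_imp_le)
  next
    case False
    have "max 0 t \<in> T" using T by (simp add: max_def)
    moreover have "t < max 0 t \<or> (\<forall>y\<in>T. y \<le> t)"
      using False by (cases "t < 0") (auto simp: not_less max_def)
    ultimately show ?thesis by blast
  qed
  then obtain b where b: "b \<in> T" "0 \<le> b" "t \<le> b" "t < b \<or> (\<forall>y\<in>T. y \<le> t)"
    unfolding max.bounded_iff by blast
  have sub: "{a..b} \<subseteq> T"
    using mem_is_interval_1_I[OF T(1) a(1) b(1)] by auto
  \<comment> \<open>If an end point of the segment equals \<open>t\<close>, then \<open>T\<close> has no points beyond it, so any bound will
    do there.\<close>
  define U where "U = {(if a < t then a else t - 1)<..<(if t < b then b else t + 1)}"
  have "at t within T = at t within {a..b}"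
  proof (rule at_within_nhd)
    show "t \<in> U" "open U"
      by (auto simp: U_def)
    have "x \<in> {a..b}" if "x \<in> T" "x \<in> U" for x
    proof -
      have "a \<le> x"
        using that(2) a(4) bspec[of T "\<lambda>y. t \<le> y" x] that(1) a(3) unfolding U_def
        by (cases "a < t") auto
      moreover have "x \<le> b"
        using that(2) b(4) bspec[of T "\<lambda>y. y \<le> t" x] that(1) b(3) unfolding U_def
        by (cases "t < b") auto
      ultimately show ?thesis by simp
    qed
    then show "T \<inter> U - {t} = {a..b} \<inter> U - {t}"
      using sub by auto
  qed
  then show thesis
    using that[of a b] a b sub by auto
qed

lemma interval_integral_has_vector_derivative:
  fixes f :: "real \<Rightarrow> 'a::euclidean_space"
  assumes T: "is_interval T" "0 \<in> T" "t \<in> T" and f: "continuous_on T f"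
  shows "((\<lambda>u. LBINT s=0..u. f s) has_vector_derivative f t) (at t within T)"
proof -
  obtain a b where ab: "a \<le> 0" "0 \<le> b" "a \<le> t" "t \<le> b" "{a..b} \<subseteq> T"
    "at t within T = at t within {a..b}"
    using interval_segment_nhd[OF T] by blast
  show ?thesis
    using interval_integral_FTC2[OF ab(1,2) continuous_on_subset[OF f ab(5)] ab(3,4)] ab(6)
    by (simp add: zero_ereal_def)
qed

lemma eq_on_interval_if_derivative_zero:
  fixes f :: "real \<Rightarrow> 'a::real_normed_vector"
  assumes T: "is_interval T" "0 \<in> T" "t \<in> T"
    and D: "\<And>t. t \<in> T \<Longrightarrow> (f has_vector_derivative 0) (at t within T)"
  shows "f t = f 0"
  using has_derivative_zero_constant[of T f] T D
  by (auto simp: is_interval_convex_1 has_vector_derivative_def)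

text \<open>Gronwall in both time directions: \<open>exp (- 2 L t) |D|\<^sup>2\<close> is nonincreasing and
  \<open>exp (2 L t) |D|\<^sup>2\<close> is nondecreasing. The first bounds \<open>D\<close> to the right of \<open>0\<close>, the second to
  the left.\<close>

lemma zero_if_linear_growth:
  fixes D :: "real \<Rightarrow> 'a::real_inner"
  assumes T: "is_interval T" "0 \<in> T" "t \<in> T"
    and D: "\<And>t. t \<in> T \<Longrightarrow> (D has_vector_derivative D' t) (at t within T)"
    and L: "\<And>t. t \<in> T \<Longrightarrow> norm (D' t) \<le> L * norm (D t)"
    and "D 0 = 0"
  shows "D t = 0"
proof -
  have bound: "\<bar>D s \<bullet> D' s\<bar> \<le> L * (D s \<bullet> D s)" if "s \<in> T" for s
  proof -
    have "\<bar>D s \<bullet> D' s\<bar> \<le> norm (D s) * norm (D' s)"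
      by (rule Cauchy_Schwarz_ineq2)
    also have "\<dots> \<le> norm (D s) * (L * norm (D s))"
      using L[OF that] by (intro mult_left_mono) auto
    finally show ?thesis
      by (simp add: power2_norm_eq_inner[symmetric] power2_eq_square mult_ac)
  qed
  \<comment> \<open>Both weights are treated at once: \<open>c = L\<close> for negative and \<open>c = - L\<close> for positive times.\<close>
  define F where "F c s = exp (2 * c * s) * (D s \<bullet> D s)" for c s
  have F: "(F c has_derivative (\<lambda>h. h * (2 * exp (2 * c * s) * (c * (D s \<bullet> D s) + D s \<bullet> D' s))))
      (at s within {u..v})" if "{u..v} \<subseteq> T" "s \<in> {u..v}" for c s u v
  proof -
    have "s \<in> T" using that by auto
    note 1 = has_derivative_subset[OF D[OF this, unfolded has_vector_derivative_def] that(1)]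
    show ?thesis
      unfolding F_def
      by (rule has_derivative_eq_rhs, (rule derivative_intros 1)+)
        (auto simp: algebra_simps inner_commute)
  qed
  have "D t \<bullet> D t \<le> 0"
  proof (cases t "0::real" rule: linorder_cases)
    case less
    have sub: "{t..0} \<subseteq> T"
      using mem_is_interval_1_I[OF T(1) T(3) T(2)] by auto
    obtain s where s: "s \<in> {t<..<0}"
      "F L 0 - F L t = (0 - t) * (2 * exp (2 * L * s) * (L * (D s \<bullet> D s) + D s \<bullet> D' s))"
      using mvt_simple[OF less F[where c = L, OF sub]] by auto
    have "0 \<le> L * (D s \<bullet> D s) + D s \<bullet> D' s"
      using bound[OF subsetD[OF sub, of s]] s(1) by (simp add: abs_le_iff)
    then have "0 \<le> F L 0 - F L t"
      unfolding s(2) using less by (intro mult_nonneg_nonneg) auto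
    then show ?thesis
      using \<open>D 0 = 0\<close> by (simp add: F_def mult_le_0_iff)
  next
    case equal
    then show ?thesis using \<open>D 0 = 0\<close> by simp
  next
    case greater
    have sub: "{0..t} \<subseteq> T"
      using mem_is_interval_1_I[OF T] by auto
    obtain s where s: "s \<in> {0<..<t}"
      "F (-L) t - F (-L) 0 = (t - 0) * (2 * exp (2 * (-L) * s) * ((-L) * (D s \<bullet> D s) + D s \<bullet> D' s))"
      using mvt_simple[OF greater F[where c = "- L", OF sub]] by auto
    have "(-L) * (D s \<bullet> D s) + D s \<bullet> D' s \<le> 0"
      using bound[OF subsetD[OF sub, of s]] s(1) by (simp add: abs_le_iff)
    then have "F (-L) t - F (-L) 0 \<le> 0"
      unfolding s(2) using greater by (intro mult_nonneg_nonpos) auto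
    then show ?thesis
      using \<open>D 0 = 0\<close> by (simp add: F_def mult_le_0_iff)
  qed
  then show ?thesis
    using inner_ge_zero[of "D t"] by (simp add: antisym)
qed

section \<open>Trajectories as curves in the exponential family\<close>

lemma bounded_linear_zmean: "bounded_linear (zmean lam)"
  by (auto intro!: linearI simp: zmean_def linear_conv_bounded_linear[symmetric] algebra_simps
      sum.distrib scaleR_sum_right scaleR_conv_of_real[where 'a=complex] sum_distrib_left)

lemma Wint_zero [simp]: "Wint lam p 0 = 0"
  by (simp add: Wint_def flip: zero_ereal_def)

lemma residual_trajectory_continuous_on:
  assumes "residual_trajectory lam T p"
  shows "continuous_on T p"
  using assms by (auto simp: residual_trajectory_def continuous_on_eq_continuous_within
      intro: has_vector_derivative_continuous)

lemma Wint_has_vector_derivative: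
  assumes "is_interval T" "0 \<in> T" "t \<in> T" "continuous_on T p"
  shows "(Wint lam p has_vector_derivative zmean lam (p t)) (at t within T)"
  using interval_integral_has_vector_derivative[OF assms(1-3)
      bounded_linear.continuous_on[OF bounded_linear_zmean assms(4), of lam]]
  by (simp add: Wint_def[abs_def])

lemma parameter_curve_has_vector_derivative:
  assumes "(W has_vector_derivative z) (at t within T)"
  shows "((\<lambda>t. (t, Re (W t), Im (W t))) has_vector_derivative (1, Re z, Im z)) (at t within T)"
  by (intro has_vector_derivative_Pair has_vector_derivative_id
      bounded_linear.has_vector_derivative[OF bounded_linear_Re assms]
      bounded_linear.has_vector_derivative[OF bounded_linear_Im assms])

text \<open>Integrating \<open>p\<^sub>i' = p\<^sub>i (L\<^sub>i(x') - \<phi>)\<close> with \<open>x = (t, Re W, Im W)\<close> and \<open>\<phi>\<close> common to all \<open>i\<close>. Using the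
  integrating factor instead of the logarithm of \<open>p\<^sub>i\<close> allows trajectories that are only known to stay
  in the closed simplex.\<close>

lemma residual_trajectory_eq_expfam:
  assumes T: "is_interval T" "0 \<in> T" "t \<in> T"
    and p: "residual_trajectory lam T p" and p0: "p 0 \<in> open_simplex"
  shows "p t = expfam lam (p 0) (t, Re (Wint lam p t), Im (Wint lam p t))"
proof -
  define x where "x = (\<lambda>t. (t, Re (Wint lam p t), Im (Wint lam p t)))"
  define h where "h = (\<lambda>t. (1::real, Re (zmean lam (p t)), Im (zmean lam (p t))))"
  define \<phi> where "\<phi> = (\<lambda>t. \<Sum>j\<in>UNIV. p t $ j * log_weight lam j (h t))"
  define \<Phi> where "\<Phi> = (\<lambda>t::real. LBINT s=0..t. \<phi> s)"
  have cont: "continuous_on T p"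
    using p by (rule residual_trajectory_continuous_on)
  have sum1: "(\<Sum>j\<in>UNIV. p s $ j) = 1" if "s \<in> T" for s
    using p that by (auto simp: residual_trajectory_def prob_simplex_def)
  have x: "(x has_vector_derivative h s) (at s within T)" if "s \<in> T" for s
    unfolding x_def h_def
    by (intro parameter_curve_has_vector_derivative Wint_has_vector_derivative T that cont)
  have "continuous_on T \<phi>"
    unfolding \<phi>_def h_def
    by (intro continuous_intros cont bounded_linear.continuous_on[OF bounded_linear_zmean])
  then have \<Phi>: "(\<Phi> has_vector_derivative \<phi> s) (at s within T)" if "s \<in> T" for s
    unfolding \<Phi>_def by (intro interval_integral_has_vector_derivative T that)
  have p': "((\<lambda>s. p s $ i) has_real_derivative p s $ i * (log_weight lam i (h s) - \<phi> s))
      (at s within T)" if "s \<in> T" for s i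
  proof -
    have "(p has_vector_derivative replicator lam (p s) (h s)) (at s within T)"
      using p that residual_field_eq_replicator[OF sum1[OF that], of lam]
      by (auto simp: residual_trajectory_def h_def)
    from has_vector_derivative_vec_nth[OF this, of i] show ?thesis
      by (simp add: replicator_def \<phi>_def has_real_derivative_iff_has_vector_derivative)
  qed
  have const: "p t $ i * exp (\<Phi> t - log_weight lam i (x t)) =
      p 0 $ i * exp (\<Phi> 0 - log_weight lam i (x 0))" for i
  proof (rule eq_on_interval_if_derivative_zero[OF T])
    fix s assume s: "s \<in> T"
    have L: "((\<lambda>s. log_weight lam i (x s)) has_real_derivative log_weight lam i (h s)) (at s within T)"
      using bounded_linear.has_vector_derivative[OF bounded_linear_log_weight x[OF s]]
      by (simp add: has_real_derivative_iff_has_vector_derivative)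
    have "((\<lambda>s. p s $ i * exp (\<Phi> s - log_weight lam i (x s))) has_real_derivative 0) (at s within T)"
      by (rule derivative_eq_intros refl p'[OF s] L
          \<Phi>[OF s, folded has_real_derivative_iff_has_vector_derivative])+ (simp add: algebra_simps)
    then show "((\<lambda>s. p s $ i * exp (\<Phi> s - log_weight lam i (x s))) has_vector_derivative 0)
        (at s within T)"
      by (simp add: has_real_derivative_iff_has_vector_derivative)
  qed
  have "\<Phi> 0 = 0"
    by (simp add: \<Phi>_def flip: zero_ereal_def)
  moreover have "x 0 = 0"
    by (simp add: x_def zero_prod_def)
  ultimately have eq: "p t $ i = p 0 $ i * exp (log_weight lam i (x t)) * exp (- \<Phi> t)" for i
    using const[of i] by (simp add: exp_diff exp_minus field_simps)
  have "1 = (\<Sum>i\<in>UNIV. p 0 $ i * exp (log_weight lam i (x t))) * exp (- \<Phi> t)"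
    unfolding sum_distrib_right using sum1[OF T(3)] by (simp add: eq)
  then have "exp (- \<Phi> t) = 1 / (\<Sum>i\<in>UNIV. p 0 $ i * exp (log_weight lam i (x t)))"
    by (metis nonzero_eq_divide_eq mult.commute mult_zero_left zero_neq_one)
  then have "p t = expfam lam (p 0) (x t)"
    by (simp add: vec_eq_iff expfam_nth eq)
  then show ?thesis by (simp add: x_def)
qed

lemma Wint_W_solution:
  assumes T: "is_interval T" "0 \<in> T"
    and p: "residual_trajectory lam T p" and p0: "p 0 \<in> open_simplex"
  shows "W_solution lam (p 0) T (Wint lam p)"
  unfolding W_solution_def W_field_eq_zmean
  using Wint_has_vector_derivative[OF T _ residual_trajectory_continuous_on[OF p], of _ lam]
    residual_trajectory_eq_expfam[OF T _ p p0]
  by simp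

text \<open>Along the curve, \<open>W_field\<close> is \<open>zmean lam (p t)\<close>, so the parameter curve has velocity \<open>(1, Re z, Im z)\<close>
  and the chain rule produces exactly the residual field. \<open>W\<close> and \<open>Wint lam p\<close> then have the same
  derivative and both vanish at \<open>0\<close>.\<close>

lemma expfam_curve_interior_trajectory:
  assumes T: "is_interval T" "0 \<in> T"
    and p0: "p 0 \<in> open_simplex" and W: "W_solution lam (p 0) T W"
    and p: "\<And>t. t \<in> T \<Longrightarrow> p t = expfam lam (p 0) (t, Re (W t), Im (W t))"
  shows "interior_trajectory lam T p" and "t \<in> T \<Longrightarrow> W t = Wint lam p t"
proof -
  have int: "p t \<in> open_simplex" if "t \<in> T" for t
    unfolding p[OF that] by (rule expfam_in_open_simplex[OF p0])
  have W': "(W has_vector_derivative zmean lam (p t)) (at t within T)" if "t \<in> T" for t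
    using W that p[OF that] by (simp add: W_solution_def W_field_eq_zmean)
  have p': "(p has_vector_derivative residual_field lam (p t)) (at t within T)" if t: "t \<in> T" for t
  proof -
    let ?h = "(1, Re (zmean lam (p t)), Im (zmean lam (p t)))"
    have "((expfam lam (p 0) \<circ> (\<lambda>t. (t, Re (W t), Im (W t)))) has_vector_derivative
        replicator lam (expfam lam (p 0) (t, Re (W t), Im (W t))) ?h) (at t within T)"
      by (rule vector_derivative_diff_chain_within[OF
            parameter_curve_has_vector_derivative[OF W'[OF t]] has_derivative_expfam[OF p0]])
    then have "((expfam lam (p 0) \<circ> (\<lambda>t. (t, Re (W t), Im (W t)))) has_vector_derivative
        residual_field lam (p t)) (at t within T)"
      unfolding residual_field_eq_replicator[OF open_simplexD(2)[OF int[OF t]]] by (simp add: p[OF t])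
    then show ?thesis
      by (rule has_vector_derivative_transform[OF t, rotated]) (simp add: p)
  qed
  show traj: "interior_trajectory lam T p"
    using int p' by (force simp: interior_trajectory_def residual_trajectory_def
        open_simplex_def prob_simplex_def intro: less_imp_le)
  show "W t = Wint lam p t" if "t \<in> T"
  proof -
    have "continuous_on T p"
      using traj by (auto simp: interior_trajectory_def intro: residual_trajectory_continuous_on)
    then have "((\<lambda>t. W t - Wint lam p t) has_vector_derivative 0) (at s within T)" if "s \<in> T" for s
      using has_vector_derivative_diff[OF W'[OF that] Wint_has_vector_derivative[OF T that, of p lam]]
      by simp
    then have "W t - Wint lam p t = W 0 - Wint lam p 0"
      by (rule eq_on_interval_if_derivative_zero[OF T \<open>t \<in> T\<close>])
    then show ?thesis
      using W by (simp add: W_solution_def)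
  qed
qed

text \<open>The differential of \<open>W_field\<close> in the direction \<open>h\<close> is \<open>\<Sum>i. \<lambda>\<^sub>i p\<^sub>i (L\<^sub>i h - \<Sum>j. p\<^sub>j L\<^sub>j h)\<close>,
  where \<open>L\<^sub>i h\<close> stands for \<open>L\<^sub>i(0, Re h, Im h)\<close>. Each
  \<open>|L\<^sub>i h|\<close> is at most \<open>8 B |h|\<close> with \<open>B = \<Sum>j. |\<lambda>\<^sub>j|\<close>, so the bracket is at most \<open>16 B |h|\<close>, and
  averaging over the weights \<open>p\<^sub>i\<close> costs one more factor \<open>B\<close>.\<close>

lemma W_field_lipschitz:
  assumes p0: "p0 \<in> open_simplex"
  shows "cmod (W_field lam p0 t v - W_field lam p0 t w)
    \<le> 16 * (\<Sum>j\<in>UNIV. cmod (lam $ j))\<^sup>2 * cmod (v - w)"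
proof -
  define B where "B = (\<Sum>j\<in>UNIV. cmod (lam $ j))"
  have lam_le: "cmod (lam $ i) \<le> B" for i
    unfolding B_def by (rule member_le_sum) auto
  have "0 \<le> B"
    unfolding B_def by (intro sum_nonneg) auto
  let ?x = "\<lambda>w. (t, Re w, Im w)" and ?h = "\<lambda>h. (0::real, Re h, Im h)"
  let ?D = "\<lambda>w h. zmean lam (replicator lam (expfam lam p0 (?x w)) (?h h))"
  have deriv: "((\<lambda>w. W_field lam p0 t w) has_derivative ?D w) (at w within UNIV)" for w
  proof -
    have "(?x has_derivative ?h) (at w)"
      by (intro derivative_intros)
    from diff_chain_at[OF this has_derivative_expfam[OF p0]]
    have "((expfam lam p0 \<circ> ?x) has_derivative (replicator lam (expfam lam p0 (?x w)) \<circ> ?h)) (at w)"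
      by simp
    from bounded_linear.has_derivative[OF bounded_linear_zmean this]
    show ?thesis
      by (simp add: W_field_eq_zmean o_def)
  qed
  have bound: "cmod (zmean lam (replicator lam p (?h h))) \<le> 16 * B\<^sup>2 * cmod h"
    if "p \<in> open_simplex" for p h
  proof -
    have p: "0 < p $ i" "(\<Sum>j\<in>UNIV. p $ j) = 1" for i
      using open_simplexD[OF that] by auto
    have L: "\<bar>log_weight lam i (?h h)\<bar> \<le> 8 * B * cmod h" for i
    proof -
      have "log_weight lam i (?h h) = 8 * Re (cnj (lam $ i) * h)"
        by (simp add: log_weight_def algebra_simps)
      moreover have "\<bar>Re (cnj (lam $ i) * h)\<bar> \<le> cmod (lam $ i) * cmod h"
        using abs_Re_le_cmod[of "cnj (lam $ i) * h"] by (simp add: norm_mult)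
      moreover have "cmod (lam $ i) * cmod h \<le> B * cmod h"
        by (intro mult_right_mono lam_le) auto
      ultimately show ?thesis by (simp add: abs_mult)
    qed
    have avg: "\<bar>\<Sum>j\<in>UNIV. p $ j * log_weight lam j (?h h)\<bar> \<le> 8 * B * cmod h"
    proof -
      have "\<bar>\<Sum>j\<in>UNIV. p $ j * log_weight lam j (?h h)\<bar> \<le> (\<Sum>j\<in>UNIV. p $ j * (8 * B * cmod h))"
        using p(1) L
        by (intro order_trans[OF sum_abs] sum_mono)
          (auto simp: abs_mult abs_of_pos mult.assoc intro!: mult_left_mono intro: less_imp_le)
      then show ?thesis
        by (simp add: p(2) flip: sum_distrib_right)
    qed
    have "cmod (zmean lam (replicator lam p (?h h))) \<le> (\<Sum>i\<in>UNIV. p $ i * (16 * B * cmod h * B))"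
      unfolding zmean_def
    proof (rule order_trans[OF norm_sum], rule sum_mono)
      fix i
      have "\<bar>log_weight lam i (?h h) - (\<Sum>j\<in>UNIV. p $ j * log_weight lam j (?h h))\<bar> \<le> 16 * B * cmod h"
        using L[of i] avg by linarith
      then have "\<bar>replicator lam p (?h h) $ i\<bar> \<le> p $ i * (16 * B * cmod h)"
        unfolding replicator_def vec_lambda_beta abs_mult abs_of_pos[OF p(1)]
        using p(1)[of i] by (intro mult_left_mono) auto
      then have "\<bar>replicator lam p (?h h) $ i\<bar> * cmod (lam $ i) \<le> p $ i * (16 * B * cmod h) * B"
        using p(1)[of i] lam_le[of i] \<open>0 \<le> B\<close> by (intro mult_mono) auto
      then show "cmod (of_real (replicator lam p (?h h) $ i) * lam $ i)
          \<le> p $ i * (16 * B * cmod h * B)"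
        by (simp add: norm_mult mult.assoc)
    qed
    also have "\<dots> = 16 * B\<^sup>2 * cmod h"
      unfolding sum_distrib_right[symmetric] p(2) by (simp add: power2_eq_square)
    finally show ?thesis .
  qed
  have "norm (W_field lam p0 t v - W_field lam p0 t w) \<le> (16 * B\<^sup>2) * norm (v - w)"
    by (rule differentiable_bound[OF convex_UNIV deriv])
      (auto intro!: onorm_le bound expfam_in_open_simplex[OF p0])
  then show ?thesis
    by (simp add: B_def)
qed

lemma W_solution_unique:
  assumes T: "is_interval T" "0 \<in> T" "t \<in> T" and p0: "p0 \<in> open_simplex"
    and V: "W_solution lam p0 T V" and W: "W_solution lam p0 T W"
  shows "V t = W t"
proof -
  have "V t - W t = 0"
  proof (rule zero_if_linear_growth[OF T])
    show "((\<lambda>t. V t - W t) has_vector_derivative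
        W_field lam p0 s (V s) - W_field lam p0 s (W s)) (at s within T)" if "s \<in> T" for s
      using V W that by (auto simp: W_solution_def intro!: has_vector_derivative_diff)
  qed (use V W W_field_lipschitz[OF p0] in \<open>auto simp: W_solution_def\<close>)
  then show ?thesis by simp
qed

section \<open>Generic spectra and the embedding\<close>

text \<open>The equation \<open>t |z|\<^sup>2 + w \<bullet> z = c\<close> describes a circle (if not
  empty or a point) with centre \<open>- w / (2 t)\<close> when \<open>t \<noteq> 0\<close>, and a line with normal \<open>w\<close>, hence direction \<open>\<i> w\<close>, when \<open>t = 0\<close> and \<open>w \<noteq> 0\<close>; conversely every circle and
  every line has such an equation.\<close>

lemma generic_spectrum_iff:
  "generic_spectrum mu \<longleftrightarrow>
     (\<forall>t w c. (\<forall>i. t * (cmod (mu $ i))\<^sup>2 + w \<bullet> mu $ i = c) \<longrightarrow> t = 0 \<and> w = 0)"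
proof (intro iffI allI impI)
  fix t w c
  assume gen: "generic_spectrum mu" and eq: "\<forall>i. t * (cmod (mu $ i))\<^sup>2 + w \<bullet> mu $ i = c"
  have t: "t = 0"
  proof (rule ccontr)
    assume "t \<noteq> 0"
    define R where "R = c / t + (cmod (w /\<^sub>R (2 * t)))\<^sup>2"
    have "(cmod (mu $ i + w /\<^sub>R (2 * t)))\<^sup>2 = R" for i
    proof -
      have expand: "(cmod (x + v))\<^sup>2 = (cmod x)\<^sup>2 + 2 * (v \<bullet> x) + (cmod v)\<^sup>2" for x v
        unfolding cmod_power2 inner_complex_def by (simp add: power2_eq_square algebra_simps)
      have "(cmod (mu $ i + w /\<^sub>R (2 * t)))\<^sup>2 =
          (cmod (mu $ i))\<^sup>2 + w \<bullet> mu $ i / t + (cmod (w /\<^sub>R (2 * t)))\<^sup>2"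
        unfolding expand by (simp add: mult.commute[of "inverse t"] flip: divide_inverse)
      also have "(cmod (mu $ i))\<^sup>2 + w \<bullet> mu $ i / t = c / t"
        using eq[rule_format, of i] \<open>t \<noteq> 0\<close> by (simp add: field_simps)
      finally show ?thesis by (simp add: R_def)
    qed
    then have "mu $ i \<in> sphere (- (w /\<^sub>R (2 * t))) (sqrt R)" for i
      by (metis dist_commute dist_norm diff_minus_eq_add mem_sphere norm_ge_zero real_sqrt_unique)
    then show False
      using gen unfolding generic_spectrum_def by blast
  qed
  have "w = 0"
  proof (rule ccontr)
    assume "w \<noteq> 0"
    have "x - y = (((\<i> * w) \<bullet> (x - y)) / (cmod w)\<^sup>2) *\<^sub>R (\<i> * w)"
      if "x \<in> range (\<lambda>i. mu $ i)" "y \<in> range (\<lambda>i. mu $ i)" for x y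
    proof -
      have "w \<bullet> (x - y) = 0"
        using that eq t by (auto simp: inner_diff_right)
      then have orth: "Re w * Re (x - y) + Im w * Im (x - y) = 0"
        by (simp add: inner_complex_def)
      have "(cmod w)\<^sup>2 * Re (x - y) = - ((\<i> * w) \<bullet> (x - y)) * Im w"
        "(cmod w)\<^sup>2 * Im (x - y) = ((\<i> * w) \<bullet> (x - y)) * Re w"
        using orth unfolding cmod_power2 inner_complex_def by simp_all algebra+
      then show ?thesis
        using \<open>w \<noteq> 0\<close> by (simp add: complex_eq_iff field_simps)
    qed
    then have "collinear (range (\<lambda>i. mu $ i))"
      unfolding collinear_def by blast
    then show False
      using gen by (simp add: generic_spectrum_def)
  qed
  with t show "t = 0 \<and> w = 0" by simp
next
  assume ind: "\<forall>t w c. (\<forall>i. t * (cmod (mu $ i))\<^sup>2 + w \<bullet> mu $ i = c) \<longrightarrow> t = 0 \<and> w = 0"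
  show "generic_spectrum mu"
    unfolding generic_spectrum_def
  proof (intro conjI notI)
    assume "collinear (range (\<lambda>i. mu $ i))"
    then obtain u where u: "u \<noteq> 0" "\<And>i j. \<exists>c. mu $ i - mu $ j = c *\<^sub>R u"
      unfolding collinear by blast
    have "0 * (cmod (mu $ i))\<^sup>2 + (\<i> * u) \<bullet> mu $ i = (\<i> * u) \<bullet> mu $ undefined" for i
    proof -
      obtain c where "mu $ i - mu $ undefined = c *\<^sub>R u"
        using u(2) by blast
      then have "(\<i> * u) \<bullet> (mu $ i - mu $ undefined) = 0"
        by (simp add: inner_complex_def)
      then show ?thesis
        by (simp add: inner_diff_right)
    qed
    with ind have "\<i> * u = 0" by blast
    with u(1) show False by simp
  next
    assume "\<exists>c r. range (\<lambda>i. mu $ i) \<subseteq> sphere c r"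
    then obtain c r where "range (\<lambda>i. mu $ i) \<subseteq> sphere c r"
      by blast
    then have "mu $ i \<in> sphere c r" for i
      by blast
    then have "(cmod (c - mu $ i))\<^sup>2 = r\<^sup>2" for i
      by (simp add: dist_norm)
    then have "1 * (cmod (mu $ i))\<^sup>2 + ((-2) *\<^sub>R c) \<bullet> mu $ i = r\<^sup>2 - (cmod c)\<^sup>2" for i
      unfolding cmod_power2 inner_complex_def by (simp add: power2_eq_square algebra_simps)
    with ind have "(1::real) = 0" by blast
    then show False by simp
  qed
qed

lemma generic_log_weight_injective:
  assumes "generic_spectrum lam" and eq: "\<And>i. log_weight lam i x = c"
  shows "x = 0"
proof -
  obtain t a b where x: "x = (t, a, b)"
    by (cases x) auto
  have "(-4 * t) * (cmod (lam $ i))\<^sup>2 + (8 *\<^sub>R Complex a b) \<bullet> lam $ i = c" for i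
    using eq[of i] by (simp add: x log_weight_def inner_complex_def algebra_simps)
  with assms(1)[unfolded generic_spectrum_iff] have "-4 * t = 0 \<and> 8 *\<^sub>R Complex a b = 0"
    by blast
  then show ?thesis
    by (simp add: x zero_prod_def complex_eq_iff)
qed

text \<open>Fix one reference coordinate \<open>k\<close>. Subtracting it removes the normalising constant:
  \<open>ln (p\<^sub>i / p0\<^sub>i) - ln (p\<^sub>k / p0\<^sub>k) = L\<^sub>i x - L\<^sub>k x\<close> at \<open>p = expfam lam p0 x\<close>. The right-hand side is an
  injective linear map of \<open>x\<close>, so a linear left inverse of it recovers \<open>x\<close> continuously from \<open>p\<close>.
  The differential is injective for the same reason: a vector \<open>h\<close> in its kernel makes every \<open>L\<^sub>i h\<close> equal
  to their common mean.\<close>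

lemma regular_embedding_expfam:
  assumes p0: "p0 \<in> open_simplex" and gen: "generic_spectrum lam"
  shows "regular_embedding (expfam lam p0)"
proof -
  let ?f = "expfam lam p0"
  have cont: "continuous_on S ?f" for S
    by (rule has_derivative_continuous_on[OF has_derivative_expfam[OF p0]])
  have lin: "bounded_linear (replicator lam (?f x))" for x
    using has_derivative_expfam[OF p0, of lam x UNIV] by (rule has_derivative_bounded_linear)
  define D where "D = (\<lambda>x. Blinfun (replicator lam (?f x)))"
  have D: "blinfun_apply (D x) = replicator lam (?f x)" for x
    by (simp add: D_def bounded_linear_Blinfun_apply[OF lin])
  have "continuous_on UNIV D"
    by (rule continuous_on_blinfun_componentwise)
      (auto simp: D replicator_def intro!: continuous_intros cont)
  moreover have "inj (blinfun_apply (D x))" for x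
    unfolding D
  proof (subst linear_injective_0[OF bounded_linear.linear[OF lin]], intro allI impI)
    fix h assume zero: "replicator lam (?f x) h = 0"
    have "log_weight lam i h = (\<Sum>j\<in>UNIV. ?f x $ j * log_weight lam j h)" for i
    proof -
      have "replicator lam (?f x) h $ i = 0"
        unfolding zero by simp
      then show ?thesis
        using open_simplexD(1)[OF expfam_in_open_simplex[OF p0], of lam x i]
        unfolding replicator_def vec_lambda_beta mult_eq_0_iff right_minus_eq by auto
    qed
    then show "h = 0"
      by (rule generic_log_weight_injective[OF gen])
  qed
  moreover have "\<exists>g. homeomorphism UNIV (range ?f) ?f g"
  proof -
    \<comment> \<open>\<open>undefined\<close> only names an arbitrary index, the reference coordinate.\<close>
    define M where "M x = (\<chi> i. log_weight lam i x - log_weight lam undefined x)" for x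
    define G where "G p = (\<chi> i. ln (p $ i / p0 $ i) - ln (p $ undefined / p0 $ undefined))" for p
    have "linear M"
      unfolding M_def
      by (intro linearI) (simp_all add: vec_eq_iff algebra_simps log_weight_add log_weight_scale)
    moreover have "inj M"
      unfolding linear_injective_0[OF \<open>linear M\<close>]
      by (auto simp: M_def vec_eq_iff intro: generic_log_weight_injective[OF gen])
    ultimately obtain g' where g': "linear g'" "g' \<circ> M = id"
      using linear_injective_left_inverse by blast
    have G: "G (?f x) = M x" for x
    proof -
      have "ln (?f x $ i / p0 $ i) =
          log_weight lam i x - ln (\<Sum>j\<in>UNIV. p0 $ j * exp (log_weight lam j x))" for i
        using open_simplexD(1)[OF p0, of i] partition_sum_pos[OF p0, of lam x]
        by (simp add: expfam_nth ln_div)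
      then show ?thesis
        by (simp add: G_def M_def)
    qed
    have inv: "(g' \<circ> G) (?f x) = x" for x
      using g'(2) by (simp add: G pointfree_idE)
    have pos: "0 < p $ i / p0 $ i" if "p \<in> range ?f" for p i
      using that open_simplexD(1)[OF expfam_in_open_simplex[OF p0]] open_simplexD(1)[OF p0]
      by auto
    have "continuous_on (range ?f) G"
      unfolding G_def using pos open_simplexD(1)[OF p0]
      by (intro continuous_intros ballI) (auto simp: less_le)
    then have "continuous_on (range ?f) (g' \<circ> G)"
      by (rule continuous_on_compose[OF _ linear_continuous_on[OF
            g'(1)[unfolded linear_conv_bounded_linear]]])
    then have "homeomorphism UNIV (range ?f) ?f (g' \<circ> G)"
      unfolding homeomorphism_def using cont inv by (auto simp: image_image simp del: o_apply)
    then show ?thesis by blast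
  qed
  ultimately show ?thesis
    unfolding regular_embedding_def
    by (intro conjI exI[of _ D]) (auto simp: D has_derivative_expfam[OF p0])
qed

text \<open>The complement is the projection, along the compact unit sphere of coefficient vectors
  \<open>(t, w, c)\<close>, of a closed set. A unit vector satisfying the equations cannot have \<open>t = 0\<close> and \<open>w = 0\<close>, since
  then \<open>c\<close> would vanish as well.\<close>

lemma open_generic_spectrum: "open {mu :: complex ^ 'n. generic_spectrum mu}"
proof -
  let ?C = "{(v, mu :: complex ^ 'n). \<forall>i. fst v * (cmod (mu $ i))\<^sup>2 + fst (snd v) \<bullet> mu $ i = snd (snd v)}
    :: ((real \<times> complex \<times> real) \<times> (complex ^ 'n)) set"
  have "closed ?C"
    unfolding case_prod_beta by (intro closed_Collect_all closed_Collect_eq continuous_intros)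
  then have "closed {mu. \<exists>v. v \<in> sphere 0 1 \<and> (v, mu) \<in> ?C}"
    by (intro closed_compact_projection) auto
  moreover have "{mu. \<exists>v. v \<in> sphere 0 1 \<and> (v, mu) \<in> ?C} = - {mu. generic_spectrum mu}"
  proof (intro set_eqI iffI)
    fix mu assume "mu \<in> {mu. \<exists>v. v \<in> sphere 0 1 \<and> (v, mu) \<in> ?C}"
    then obtain t w c where v: "norm (t, w, c) = 1" "\<And>i. t * (cmod (mu $ i))\<^sup>2 + w \<bullet> mu $ i = c"
      by auto
    have "\<not> (t = 0 \<and> w = 0)"
    proof
      assume "t = 0 \<and> w = 0"
      with v(2) have "c = 0" by simp
      with v(1) \<open>t = 0 \<and> w = 0\<close> show False by (simp add: norm_Pair)
    qed
    with v(2) show "mu \<in> - {mu. generic_spectrum mu}"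
      unfolding generic_spectrum_iff by blast
  next
    fix mu :: "complex ^ 'n" assume "mu \<in> - {mu. generic_spectrum mu}"
    then obtain t w c where v: "\<not> (t = 0 \<and> w = 0)" "\<And>i. t * (cmod (mu $ i))\<^sup>2 + w \<bullet> mu $ i = c"
      unfolding generic_spectrum_iff by blast
    define r where "r = norm (t, w, c)"
    have "r \<noteq> 0"
      unfolding r_def norm_eq_zero using v(1) by (auto simp: zero_prod_def)
    have "(t, w, c) /\<^sub>R r \<in> sphere 0 1"
      using \<open>r \<noteq> 0\<close> unfolding mem_sphere dist_0_norm norm_scaleR by (simp add: r_def)
    moreover have "((t, w, c) /\<^sub>R r, mu) \<in> ?C"
      using v(2) by (auto simp: scaleR_prod_def mult.assoc simp flip: distrib_left)
    ultimately show "mu \<in> {mu. \<exists>v. v \<in> sphere 0 1 \<and> (v, mu) \<in> ?C}"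
      by blast
  qed
  ultimately show ?thesis
    by (simp add: closed_def)
qed

text \<open>The \<open>3 \<times> 3\<close> determinant with rows \<open>(|\<cdot>|\<^sup>2, Re, Im)\<close> at \<open>u\<close>, \<open>v\<close>, \<open>w\<close>. It vanishes iff
  \<open>0\<close>, \<open>u\<close>, \<open>v\<close>, \<open>w\<close> lie on a common line or circle.\<close>

definition circle_det :: "complex \<Rightarrow> complex \<Rightarrow> complex \<Rightarrow> real" where
  "circle_det u v w =
     ((Re u)\<^sup>2 + (Im u)\<^sup>2) * (Re v * Im w - Im v * Re w)
     - ((Re v)\<^sup>2 + (Im v)\<^sup>2) * (Re u * Im w - Im u * Re w)
     + ((Re w)\<^sup>2 + (Im w)\<^sup>2) * (Re u * Im v - Im u * Re v)"

lemma cramer_3_homogeneous: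
  fixes t a b :: real
  assumes eqs: "t * q1 + a * x1 + b * y1 = 0" "t * q2 + a * x2 + b * y2 = 0"
      "t * q3 + a * x3 + b * y3 = 0"
    and s: "s \<in> {t, a, b}"
  shows "(q1 * (x2 * y3 - y2 * x3) - q2 * (x1 * y3 - y1 * x3) + q3 * (x1 * y2 - y1 * x2)) * s = 0"
    (is "?D * s = 0")
proof -
  let ?e1 = "t * q1 + a * x1 + b * y1" and ?e2 = "t * q2 + a * x2 + b * y2"
    and ?e3 = "t * q3 + a * x3 + b * y3"
  have "?D * t = (x2 * y3 - y2 * x3) * ?e1 - (x1 * y3 - y1 * x3) * ?e2 + (x1 * y2 - y1 * x2) * ?e3"
    "?D * a = - (q2 * y3 - y2 * q3) * ?e1 + (q1 * y3 - y1 * q3) * ?e2 - (q1 * y2 - y1 * q2) * ?e3"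
    "?D * b = (q2 * x3 - x2 * q3) * ?e1 - (q1 * x3 - x1 * q3) * ?e2 + (q1 * x2 - x1 * q2) * ?e3"
    by (simp_all add: algebra_simps)
  then show ?thesis
    using s unfolding eqs by auto
qed

text \<open>With \<open>\<mu>\<^sub>a\<close> moved to the origin, the constant \<open>c\<close> drops out of the equation of the circle and \<open>w\<close>
  becomes \<open>w + 2 t \<mu>\<^sub>a\<close>. The other three points then give a homogeneous \<open>3 \<times> 3\<close> system for the
  coefficients.\<close>

lemma generic_spectrum_if_circle_det:
  assumes det: "circle_det (mu $ b - mu $ a) (mu $ c - mu $ a) (mu $ d - mu $ a) \<noteq> 0"
  shows "generic_spectrum mu"
  unfolding generic_spectrum_iff
proof (intro allI impI)
  fix t w k assume eq: "\<forall>i. t * (cmod (mu $ i))\<^sup>2 + w \<bullet> mu $ i = k"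
  define \<alpha> where "\<alpha> = Re w + 2 * t * Re (mu $ a)"
  define \<beta> where "\<beta> = Im w + 2 * t * Im (mu $ a)"
  have lin: "t * ((Re (mu $ i - mu $ a))\<^sup>2 + (Im (mu $ i - mu $ a))\<^sup>2)
      + \<alpha> * Re (mu $ i - mu $ a) + \<beta> * Im (mu $ i - mu $ a) = 0" for i
    using eq[rule_format, of i] eq[rule_format, of a]
    unfolding cmod_power2 inner_complex_def \<alpha>_def \<beta>_def
    by (simp add: power2_eq_square algebra_simps)
  have "circle_det (mu $ b - mu $ a) (mu $ c - mu $ a) (mu $ d - mu $ a) * s = 0"
    if "s \<in> {t, \<alpha>, \<beta>}" for s
    unfolding circle_det_def using cramer_3_homogeneous[OF lin lin lin] that by blast
  then show "t = 0 \<and> w = 0"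
    using det by (simp add: \<alpha>_def \<beta>_def complex_eq_iff)
qed

lemma circle_det_polynomial_on_line:
  "\<exists>P. \<forall>s. circle_det (u0 + s *\<^sub>R u1) (v0 + s *\<^sub>R v1) (w0 + s *\<^sub>R w1) = poly P s"
proof -
  define x where "x z0 z1 = [:Re z0, Re z1:]" for z0 z1 :: complex
  define y where "y z0 z1 = [:Im z0, Im z1:]" for z0 z1 :: complex
  have x: "Re (z0 + s *\<^sub>R z1) = poly (x z0 z1) s" and y: "Im (z0 + s *\<^sub>R z1) = poly (y z0 z1) s"
    for z0 z1 s
    by (simp_all add: x_def y_def)
  show ?thesis
    unfolding circle_det_def x y
    by (simp only: flip: poly_add poly_diff poly_mult poly_power) blast
qed

text \<open>A generic spectrum \<open>nu\<close> exists because \<open>0\<close>, \<open>1\<close>, \<open>\<i>\<close>, \<open>2\<close> lie on no common line or circle. On the line from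
  \<open>mu\<close> to \<open>nu\<close> the determinant is a polynomial in the parameter that is nonzero at \<open>1\<close>, so
  there are parameters arbitrarily close to \<open>0\<close> where it does not vanish.\<close>

lemma dense_generic_spectrum:
  assumes "4 \<le> CARD('n)"
  shows "closure {mu :: complex ^ 'n. generic_spectrum mu} = UNIV"
proof -
  obtain f :: "nat \<Rightarrow> 'n" where f: "bij_betw f {0..<CARD('n)} UNIV"
    using ex_bij_betw_nat_finite[of "UNIV :: 'n set"] by auto
  then have ne: "f i \<noteq> f j" if "i < 4" "j < 4" "i \<noteq> j" for i j
    using that assms by (auto simp: bij_betw_def inj_on_def)
  define nu :: "complex ^ 'n" where
    "nu = (\<chi> i. if i = f 1 then 1 else if i = f 2 then \<i> else if i = f 3 then 2 else 0)"
  have nu: "nu $ f 0 = 0" "nu $ f 1 = 1" "nu $ f 2 = \<i>" "nu $ f 3 = 2"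
    using ne by (auto simp: nu_def)
  have "\<exists>mu'\<in>{mu. generic_spectrum mu}. dist mu' mu < e" if "0 < e" for mu :: "complex ^ 'n" and e
  proof -
    let ?d = "\<lambda>m::complex ^ 'n. circle_det (m $ f 1 - m $ f 0) (m $ f 2 - m $ f 0) (m $ f 3 - m $ f 0)"
    let ?l = "\<lambda>s. mu + s *\<^sub>R (nu - mu)"
    have "?l s $ i - ?l s $ j = (mu $ i - mu $ j) + s *\<^sub>R ((nu - mu) $ i - (nu - mu) $ j)" for s i j
      by (simp add: algebra_simps)
    then obtain P where P: "\<And>s. ?d (?l s) = poly P s"
      using circle_det_polynomial_on_line by metis
    have "?d nu \<noteq> 0"
      unfolding nu by (simp add: circle_det_def)
    then have "poly P 1 \<noteq> 0"
      using P[of 1] by simp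
    then have "finite {s. poly P s = 0}"
      by (intro poly_roots_finite) auto
    moreover define \<delta> where "\<delta> = e / (norm (nu - mu) + 1)"
    have "0 < \<delta>"
      using \<open>0 < e\<close> by (auto simp: \<delta>_def intro!: divide_pos_pos add_nonneg_pos)
    then have "infinite {0<..<\<delta>}"
      by simp
    ultimately have "\<not> {0<..<\<delta>} \<subseteq> {s. poly P s = 0}"
      using finite_subset by blast
    then obtain s where s: "0 < s" "s < \<delta>" "poly P s \<noteq> 0"
      unfolding subset_iff greaterThanLessThan_iff mem_Collect_eq by blast
    have "generic_spectrum (?l s)"
      using s(3) unfolding P[symmetric] by (rule generic_spectrum_if_circle_det)
    moreover have "dist (?l s) mu < e"
    proof -
      have "dist (?l s) mu = s * norm (nu - mu)"
        using s(1) by (simp add: dist_norm)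
      also have "\<dots> \<le> s * (norm (nu - mu) + 1)"
        using s(1) by simp
      also have "\<dots> < \<delta> * (norm (nu - mu) + 1)"
        using s(2) by (intro mult_strict_right_mono) (auto intro: add_nonneg_pos)
      also have "\<dots> = e"
        using add_nonneg_pos[OF norm_ge_zero zero_less_one, of "nu - mu"] by (simp add: \<delta>_def)
      finally show ?thesis .
    qed
    ultimately show ?thesis by blast
  qed
  then show ?thesis
    by (auto simp: closure_approachable)
qed

section \<open>The interior of the simplex\<close>

lemma openin_open_simplex:
  "openin (top_of_set prob_simplex) (open_simplex :: (real ^ 'n) set)"
proof -
  have "open {p :: real ^ 'n. \<forall>i. 0 < p $ i}"
    unfolding Collect_all_eq by (intro open_INT ballI open_Collect_less continuous_intros) simp
  moreover have "open_simplex = prob_simplex \<inter> {p :: real ^ 'n. \<forall>i. 0 < p $ i}"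
    by (auto simp: open_simplex_def prob_simplex_def intro: less_imp_le)
  ultimately show ?thesis
    by (auto simp: openin_open)
qed

lemma closure_open_simplex: "closure (open_simplex :: (real ^ 'n) set) = prob_simplex"
proof (rule closure_unique)
  show "open_simplex \<subseteq> (prob_simplex :: (real ^ 'n) set)"
    by (auto simp: open_simplex_def prob_simplex_def intro: less_imp_le)
  show "closed (prob_simplex :: (real ^ 'n) set)"
    unfolding prob_simplex_def Collect_conj_eq
    by (intro closed_Int closed_Collect_all closed_Collect_le closed_Collect_eq continuous_intros)
  fix S :: "(real ^ 'n) set" assume S: "open_simplex \<subseteq> S" "closed S"
  show "prob_simplex \<subseteq> S"
  proof
    fix p :: "real ^ 'n" assume p: "p \<in> prob_simplex"
    \<comment> \<open>A proper mixture with the barycentre has positive coordinates.\<close>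
    define l where "l k = (1 - inverse (real (Suc k))) *\<^sub>R p
      + inverse (real (Suc k)) *\<^sub>R (\<chi> i. 1 / real CARD('n))" for k
    have "l k \<in> open_simplex" for k
    proof -
      have "0 \<le> 1 - inverse (real (Suc k))"
        by (simp add: field_simps)
      then show ?thesis
        using p by (auto simp: l_def open_simplex_def prob_simplex_def sum.distrib
            intro!: add_nonneg_pos simp flip: sum_distrib_left)
    qed
    moreover have "l \<longlonglongrightarrow> (1 - 0) *\<^sub>R p + 0 *\<^sub>R (\<chi> i. 1 / real CARD('n))"
      unfolding l_def[abs_def] by (intro tendsto_intros LIMSEQ_inverse_real_of_nat)
    ultimately show "p \<in> S"
      using S by (auto intro: closed_sequentially)
  qed
qed

section \<open>The formula, the equation for W, and genericity\<close>

theorem proposition4p4: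
  fixes lam :: "complex ^ 'n" and T :: "real set"
  assumes "is_interval T" and "0 \<in> T"
  shows
    "(\<forall>p. interior_trajectory lam T p \<longrightarrow>
       (\<forall>t\<in>T. \<forall>i. p t $ i =
          p 0 $ i * exp (- 4 * t * (cmod (lam $ i))\<^sup>2 + 8 * Re (cnj (lam $ i) * Wint lam p t)) /
          (\<Sum>j\<in>UNIV. p 0 $ j *
             exp (- 4 * t * (cmod (lam $ j))\<^sup>2 + 8 * Re (cnj (lam $ j) * Wint lam p t))))) \<and>
     (\<forall>p. interior_trajectory lam T p \<longrightarrow>
       W_solution lam (p 0) T (Wint lam p) \<and>
       (\<forall>V. W_solution lam (p 0) T V \<longrightarrow> (\<forall>t\<in>T. V t = Wint lam p t))) \<and>
     (\<forall>p W.
       (interior_trajectory lam T p \<and> (\<forall>t\<in>T. W t = Wint lam p t)) \<longleftrightarrow>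
       (p 0 \<in> open_simplex \<and> W_solution lam (p 0) T W \<and>
        (\<forall>t\<in>T. p t = expfam lam (p 0) (t, Re (W t), Im (W t))))) \<and>
     (\<forall>p. interior_trajectory lam T p \<longrightarrow> p ` T \<subseteq> range (expfam lam (p 0))) \<and>
     (\<forall>p. residual_trajectory lam T p \<and> generic_spectrum lam \<and> p 0 \<in> open_simplex \<longrightarrow>
       (\<forall>t\<in>T. p t = expfam lam (p 0) (t, Re (Wint lam p t), Im (Wint lam p t))) \<and>
       regular_embedding (expfam lam (p 0))) \<and>
     (CARD('n) \<ge> 4 \<longrightarrow>
       open {mu :: complex ^ 'n. generic_spectrum mu} \<and>
       closure {mu :: complex ^ 'n. generic_spectrum mu} = UNIV) \<and>
     (openin (top_of_set prob_simplex) (open_simplex :: (real ^ 'n) set) \<and>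
       closure (open_simplex :: (real ^ 'n) set) = prob_simplex)"
proof (intro conjI allI impI ballI)
  note T = assms
  fix p assume p: "interior_trajectory lam T p"
  then have p: "residual_trajectory lam T p" and p0: "p 0 \<in> open_simplex"
    using T by (auto simp: interior_trajectory_def)
  note gibbs = residual_trajectory_eq_expfam[OF T _ p p0]
  show "p t $ i =
      p 0 $ i * exp (- 4 * t * (cmod (lam $ i))\<^sup>2 + 8 * Re (cnj (lam $ i) * Wint lam p t)) /
      (\<Sum>j\<in>UNIV. p 0 $ j *
         exp (- 4 * t * (cmod (lam $ j))\<^sup>2 + 8 * Re (cnj (lam $ j) * Wint lam p t)))"
    if "t \<in> T" for t i
    by (subst gibbs[OF that]) (simp add: expfam_def expweight_def)
  show "W_solution lam (p 0) T (Wint lam p)"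
    by (rule Wint_W_solution[OF T p p0])
  then show "V t = Wint lam p t" if "W_solution lam (p 0) T V" "t \<in> T" for V t
    by (rule W_solution_unique[OF T that(2) p0 that(1)])
  show "p ` T \<subseteq> range (expfam lam (p 0))"
    using gibbs by (metis image_subsetI rangeI)
next
  note T = assms
  fix p W
  show "(interior_trajectory lam T p \<and> (\<forall>t\<in>T. W t = Wint lam p t)) \<longleftrightarrow>
      (p 0 \<in> open_simplex \<and> W_solution lam (p 0) T W \<and>
       (\<forall>t\<in>T. p t = expfam lam (p 0) (t, Re (W t), Im (W t))))"
  proof
    assume "interior_trajectory lam T p \<and> (\<forall>t\<in>T. W t = Wint lam p t)"
    then have p: "residual_trajectory lam T p" and p0: "p 0 \<in> open_simplex"
      and W: "\<And>t. t \<in> T \<Longrightarrow> W t = Wint lam p t"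
      using T by (auto simp: interior_trajectory_def)
    have "W_solution lam (p 0) T (Wint lam p)"
      by (rule Wint_W_solution[OF T p p0])
    then have "W_solution lam (p 0) T W"
      unfolding W_solution_def using W T(2) by (auto intro: has_vector_derivative_transform)
    then show "p 0 \<in> open_simplex \<and> W_solution lam (p 0) T W \<and>
        (\<forall>t\<in>T. p t = expfam lam (p 0) (t, Re (W t), Im (W t)))"
      using p0 W residual_trajectory_eq_expfam[OF T _ p p0] by simp
  next
    assume "p 0 \<in> open_simplex \<and> W_solution lam (p 0) T W \<and>
        (\<forall>t\<in>T. p t = expfam lam (p 0) (t, Re (W t), Im (W t)))"
    then have a: "p 0 \<in> open_simplex" "W_solution lam (p 0) T W"
      "\<And>t. t \<in> T \<Longrightarrow> p t = expfam lam (p 0) (t, Re (W t), Im (W t))"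
      by blast+
    show "interior_trajectory lam T p \<and> (\<forall>t\<in>T. W t = Wint lam p t)"
      using expfam_curve_interior_trajectory[OF T a] by blast
  qed
next
  fix p assume p: "residual_trajectory lam T p \<and> generic_spectrum lam \<and> p 0 \<in> open_simplex"
  show "p t = expfam lam (p 0) (t, Re (Wint lam p t), Im (Wint lam p t))" if "t \<in> T" for t
    using residual_trajectory_eq_expfam[OF assms that] p by blast
  show "regular_embedding (expfam lam (p 0))"
    using regular_embedding_expfam p by blast
next
  show "open {mu :: complex ^ 'n. generic_spectrum mu}"
    by (rule open_generic_spectrum)
  show "closure {mu :: complex ^ 'n. generic_spectrum mu} = UNIV" if "4 \<le> CARD('n)"
    by (rule dense_generic_spectrum[OF that])
qed (rule openin_open_simplex closure_open_simplex)+

end
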